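(* Any $n$-dimensional complex evolution algebra with maximal nilpotent index (that is, nilpotent with index of nilpotency $2^{n-1}+1$) is isomorphic to one of the pairwise non-isomorphic evolution algebras with matrix of structural constants $$\begin{pmatrix} 0 & 1 & a_{13} & \dots & a_{1,n-1} & 0\\ 0 & 0 & 1 & \dots & a_{2,n-1} & 0\\ 0 & 0 & 0 & \dots & a_{3,n-1} & 0\\ \vdots & \vdots & \vdots & \cdots & \vdots & \vdots\\ 0 & 0 & 0 & \cdots & 0 & 1\\ 0 & 0 & 0 & \cdots & 0 & 0 \end{pmatrix},$$ i.e. matrices $(a_{ij})_{i,j=1}^n$ with $a_{ij}=0$ for $i\ge j$, $a_{i,i+1}=1$ for $1\le i\le n-1$, $a_{in}=0$ for $1\le i\le n-2$, and $a_{ij}\in\mathbb C$ for $i+2\le j\le n-1$, where one of the non-zero $a_{ij}$ (with $i+2\le j\le n-1$) can be chosen equal to $1$.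
   Context: An algebra $E$ over a field $K$ is an evolution algebra if it admits a basis $\{e_1,e_2,\dots\}$ (called a natural basis) such that $e_ie_j=0$ for $i\ne j$ and $e_ie_i=\sum_k a_{ik}e_k$; the matrix $A=(a_{ij})$ is the matrix of structural constants of $E$ in this basis. Put $E^1=E$ and $E^k=\sum_{i=1}^{k-1}E^iE^{k-i}$ for $k\ge 2$, where the product of two subspaces is the linear span of all products. $E$ is nilpotent if $E^k=0$ for some $k\in\mathbb N$; the smallest such $k$ is the index of nilpotency (nilpotent index) of $E$. The maximal possible nilpotent index of an $n$-dimensional nilpotent evolution algebra is $2^{n-1}+1$.
   Formalization: Distinct displayed matrices with one parameter equal to 1 can be isomorphic (n=5, a13=0, a14=1, a24=1 or a cube root of unity); so the list is a chosen family of such matrices, meeting every class under rescaling of the natural basis, whose members are pairwise non-isomorphic. *)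

theory Defs
  imports Complex_Main "HOL-Library.Function_Algebras"
begin

text \<open>
  Algebras over a field, not necessarily associative, commutative or unital. The underlying
  vector space is a subspace of an ambient vector space whose addition is that of the type;
  this lets one type accommodate algebras of every dimension.
\<close>

record ('k, 'a) alg =
  carrier :: "'a set"
  scale :: "'k \<Rightarrow> 'a \<Rightarrow> 'a"
  mult :: "'a \<Rightarrow> 'a \<Rightarrow> 'a"

definition is_algebra :: "('k::field, 'a::ab_group_add) alg \<Rightarrow> bool" where
  "is_algebra E \<longleftrightarrow>
     vector_space (scale E) \<and>
     module.subspace (scale E) (carrier E) \<and>
     (\<forall>x\<in>carrier E. \<forall>y\<in>carrier E. mult E x y \<in> carrier E) \<and>
     (\<forall>x\<in>carrier E. \<forall>y\<in>carrier E. \<forall>z\<in>carrier E.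
        mult E (x + y) z = mult E x z + mult E y z \<and>
        mult E x (y + z) = mult E x y + mult E x z) \<and>
     (\<forall>a. \<forall>x\<in>carrier E. \<forall>y\<in>carrier E.
        mult E (scale E a x) y = scale E a (mult E x y) \<and>
        mult E x (scale E a y) = scale E a (mult E x y))"

text \<open>For an infinite-dimensional carrier this is 0, the usual convention of the library.\<close>

definition alg_dim :: "('k::field, 'a::ab_group_add) alg \<Rightarrow> nat" where
  "alg_dim E = vector_space.dim (scale E) (carrier E)"

text \<open>
  The expansion of a square \<open>e e\<close> in the basis needs no separate condition:
  it exists because the carrier is closed under multiplication and spanned by the basis.
\<close>

definition natural_basis :: "('k::field, 'a::ab_group_add) alg \<Rightarrow> 'a set \<Rightarrow> bool" where
  "natural_basis E B \<longleftrightarrow>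
     \<not> module.dependent (scale E) B \<and>
     module.span (scale E) B = carrier E \<and>
     (\<forall>x\<in>B. \<forall>y\<in>B. x \<noteq> y \<longrightarrow> mult E x y = 0)"

definition evolution_algebra :: "('k::field, 'a::ab_group_add) alg \<Rightarrow> bool" where
  "evolution_algebra E \<longleftrightarrow> is_algebra E \<and> (\<exists>B. natural_basis E B)"

definition subspace_prod ::
    "('k::field, 'a::ab_group_add) alg \<Rightarrow> 'a set \<Rightarrow> 'a set \<Rightarrow> 'a set" where
  "subspace_prod E U W = module.span (scale E) {mult E u w | u w. u \<in> U \<and> w \<in> W}"

text \<open>
  The sum of the subspaces \<open>E\<^sup>i E\<^sup>k\<^sup>-\<^sup>i\<close> is written as the span of their union. The value at
  exponent 0 is a dummy; it is excluded wherever the powers are used.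
\<close>

fun alg_power :: "('k::field, 'a::ab_group_add) alg \<Rightarrow> nat \<Rightarrow> 'a set" where
  "alg_power E k =
     (if k \<le> 1 then carrier E
      else module.span (scale E)
             (\<Union>i\<in>{1..<k}. subspace_prod E (alg_power E i) (alg_power E (k - i))))"

declare alg_power.simps [simp del]

definition nilpotent_alg :: "('k::field, 'a::ab_group_add) alg \<Rightarrow> bool" where
  "nilpotent_alg E \<longleftrightarrow> (\<exists>k\<ge>1. alg_power E k = {0})"

definition nilpotency_index :: "('k::field, 'a::ab_group_add) alg \<Rightarrow> nat" where
  "nilpotency_index E = (LEAST k. k \<ge> 1 \<and> alg_power E k = {0})"

definition isomorphic_alg ::
    "('k::field, 'a::ab_group_add) alg \<Rightarrow> ('k, 'b::ab_group_add) alg \<Rightarrow> bool" where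
  "isomorphic_alg E F \<longleftrightarrow>
     (\<exists>f. bij_betw f (carrier E) (carrier F) \<and>
       (\<forall>x\<in>carrier E. \<forall>y\<in>carrier E. f (x + y) = f x + f y) \<and>
       (\<forall>a. \<forall>x\<in>carrier E. f (scale E a x) = scale F a (f x)) \<and>
       (\<forall>x\<in>carrier E. \<forall>y\<in>carrier E. f (mult E x y) = mult F (f x) (f y)))"

text \<open>
  The evolution algebra with matrix of structural constants \<open>(A i j)\<close>, \<open>1 \<le> i, j \<le> n\<close>, in
  coordinates with respect to its natural basis: vectors are functions vanishing outside
  \<open>{1..n}\<close>, and \<open>(\<Sum>i. u\<^sub>i e\<^sub>i) (\<Sum>i. v\<^sub>i e\<^sub>i) = (\<Sum>i. u\<^sub>i v\<^sub>i e\<^sub>i e\<^sub>i)\<close>.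
  Entries of \<open>A\<close> outside that range are irrelevant.
\<close>

definition evo_alg :: "nat \<Rightarrow> (nat \<Rightarrow> nat \<Rightarrow> 'k::field) \<Rightarrow> ('k, nat \<Rightarrow> 'k) alg" where
  "evo_alg n A =
     \<lparr>carrier = {v. \<forall>i. i \<notin> {1..n} \<longrightarrow> v i = 0},
      scale = (\<lambda>a v i. a * v i),
      mult = (\<lambda>u v k. if k \<in> {1..n} then \<Sum>i=1..n. u i * v i * A i k else 0)\<rparr>"

definition unit_vec :: "nat \<Rightarrow> nat \<Rightarrow> 'k::field" where
  "unit_vec i = (\<lambda>k. if k = i then 1 else 0)"

lemma vector_space_fun: "vector_space (\<lambda>(a::'k::field) (v::'i \<Rightarrow> 'k) i. a * v i)"
  by unfold_locales (auto simp: fun_eq_iff algebra_simps)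

lemma is_algebra_evo_alg: "is_algebra (evo_alg n A)"
proof -
  interpret vector_space "\<lambda>(a::'a) (v::nat \<Rightarrow> 'a) i. a * v i"
    by (rule vector_space_fun)
  show ?thesis
    unfolding is_algebra_def evo_alg_def
    by (auto simp: vector_space_axioms subspace_def fun_eq_iff algebra_simps
          sum.distrib sum_distrib_left)
qed

lemma mult_unit_vec:
  assumes "i \<in> {1..n}" "j \<in> {1..n}"
  shows "mult (evo_alg n A) (unit_vec i) (unit_vec j) =
           (if i = j then \<Sum>k=1..n. scale (evo_alg n A) (A i k) (unit_vec k) else 0)"
proof
  fix k
  have *: "sum g {1..n} x = (\<Sum>l=1..n. g l x)" for g :: "nat \<Rightarrow> nat \<Rightarrow> 'a" and x
    by (induction n) auto
  have **: "(\<Sum>l=1..n. unit_vec i l * unit_vec j l * A l k) = (if i = j then A i k else 0)"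
  proof -
    have "(\<Sum>l=1..n. unit_vec i l * unit_vec j l * A l k) =
          (\<Sum>l=1..n. if l = i then (if i = j then A i k else 0) else 0)"
      by (intro sum.cong) (auto simp: unit_vec_def)
    then show ?thesis using assms by simp
  qed
  have ***: "(\<Sum>l=1..n. A i l * unit_vec l k) = (if k \<in> {1..n} then A i k else 0)"
  proof -
    have "(\<Sum>l=1..n. A i l * unit_vec l k) = (\<Sum>l=1..n. if l = k then A i k else 0)"
      by (intro sum.cong) (auto simp: unit_vec_def)
    then show ?thesis by simp
  qed
  have "mult (evo_alg n A) (unit_vec i) (unit_vec j) k =
      (if k \<in> {1..n} \<and> i = j then A i k else 0)"
    unfolding evo_alg_def alg.simps ** by simp
  moreover have "(\<Sum>l=1..n. scale (evo_alg n A) (A i l) (unit_vec l)) k =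
      (if k \<in> {1..n} then A i k else 0)"
    unfolding evo_alg_def alg.simps * *** ..
  ultimately show "mult (evo_alg n A) (unit_vec i) (unit_vec j) k =
      (if i = j then \<Sum>l=1..n. scale (evo_alg n A) (A i l) (unit_vec l) else 0) k"
    by (cases "i = j") (simp_all only: if_True if_False simp_thms zero_fun_apply)
qed

text \<open>
  The displayed matrices. Entries outside \<open>{1..n} \<times> {1..n}\<close> are set to 0, so that equality of
  functions is equality of \<open>n \<times> n\<close> matrices.
\<close>

definition max_nilp_matrix :: "nat \<Rightarrow> (nat \<Rightarrow> nat \<Rightarrow> complex) \<Rightarrow> bool" where
  "max_nilp_matrix n A \<longleftrightarrow>
     (\<forall>i j. \<not> (i \<in> {1..n} \<and> j \<in> {1..n}) \<longrightarrow> A i j = 0) \<and>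
     (\<forall>i\<in>{1..n}. \<forall>j\<in>{1..n}. i \<ge> j \<longrightarrow> A i j = 0) \<and>
     (\<forall>i. 1 \<le> i \<and> i + 1 \<le> n \<longrightarrow> A i (i + 1) = 1) \<and>
     (\<forall>i. 1 \<le> i \<and> i + 2 \<le> n \<longrightarrow> A i n = 0)"

text \<open>The positions of the parameters.\<close>

definition free_positions :: "nat \<Rightarrow> (nat \<times> nat) set" where
  "free_positions n = {(i, j). 1 \<le> i \<and> i + 2 \<le> j \<and> j + 1 \<le> n}"

text \<open>
  \<open>B\<close> is the matrix of structural constants of the algebra with matrix \<open>A\<close> in the rescaled
  natural basis \<open>c\<^sub>i e\<^sub>i\<close>:
  \<open>(c\<^sub>i e\<^sub>i) (c\<^sub>i e\<^sub>i) = (\<Sum>j. c\<^sub>i\<^sup>2 a\<^sub>i\<^sub>j e\<^sub>j) = (\<Sum>j. (c\<^sub>i\<^sup>2 / c\<^sub>j) a\<^sub>i\<^sub>j (c\<^sub>j e\<^sub>j))\<close>.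
\<close>

definition rescaled ::
    "nat \<Rightarrow> (nat \<Rightarrow> nat \<Rightarrow> complex) \<Rightarrow> (nat \<Rightarrow> nat \<Rightarrow> complex) \<Rightarrow> bool" where
  "rescaled n A B \<longleftrightarrow>
     (\<exists>c. (\<forall>i\<in>{1..n}. c i \<noteq> 0) \<and>
          (\<forall>i\<in>{1..n}. \<forall>j\<in>{1..n}. B i j = (c i)\<^sup>2 / c j * A i j))"

text \<open>
  A set \<open>S\<close> of displayed matrices in which one of the non-zero parameters has been chosen equal
  to 1: by rescaling the natural basis, every displayed matrix can be brought to a member of
  \<open>S\<close>, and a member of \<open>S\<close> with some non-zero parameter has a parameter equal to 1.
  One has to speak of a choice \<open>S\<close>: normalising a parameter to 1 leaves a finite group of
  rescalings by roots of unity, so already for \<open>n = 5\<close> distinct displayed matrices with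
  the same entry normalised can give isomorphic algebras (\<open>a\<^sub>1\<^sub>3 = 0\<close>, \<open>a\<^sub>1\<^sub>4 = 1\<close>, and values of
  \<open>a\<^sub>2\<^sub>4\<close> that differ by a cube root of unity).
\<close>

definition normalized_family :: "nat \<Rightarrow> (nat \<Rightarrow> nat \<Rightarrow> complex) set \<Rightarrow> bool" where
  "normalized_family n S \<longleftrightarrow>
     (\<forall>A\<in>S. max_nilp_matrix n A) \<and>
     (\<forall>A. max_nilp_matrix n A \<longrightarrow> (\<exists>B\<in>S. rescaled n A B)) \<and>
     (\<forall>A\<in>S. (\<exists>(i, j)\<in>free_positions n. A i j \<noteq> 0) \<longrightarrow>
             (\<exists>(i, j)\<in>free_positions n. A i j = 1))"

end

theory Submission
  imports Defs
begin

text \<open>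
  In a nilpotent evolution algebra the natural basis can be ordered so that the structure matrix
  is strictly upper triangular: if every basis vector outside a proper subset \<open>C\<close> had a square
  outside the span of \<open>C\<close>, multiplying by basis vectors would produce elements outside that span
  in every power (\<open>nilpotent_evo_alg_step\<close>). For a strictly upper triangular matrix, give \<open>e\<^sub>j\<close>
  the weight \<open>2\<^sup>j\<^sup>-\<^sup>1\<close>. Squaring at least doubles weights, so \<open>E\<^sup>k\<close> lives in weights at least
  \<open>k\<close>, and \<open>E\<^sup>k = 0\<close> as soon as \<open>k\<close> exceeds the largest weight. If some superdiagonal entry
  vanishes, the weights from the next index on may be halved and still double under squaring;
  then already the power with exponent \<open>2\<^sup>n\<^sup>-\<^sup>1\<close> is zero. Hence maximal index forces a non-zero
  superdiagonal (\<open>superdiagonal_nonzero\<close>).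

  Since \<open>e\<^sub>n\<close> annihilates the algebra, replacing \<open>e\<^sub>i\<close> by \<open>e\<^sub>i + b\<^sub>i e\<^sub>n\<close> leaves all squares
  unchanged and only alters the last column. Clearing its entries above the superdiagonal is a
  triangular linear system for the \<open>b\<^sub>i\<close>, and its diagonal is the superdiagonal of the matrix.
  Rescaling the basis then makes the superdiagonal equal to 1
  (\<open>triangular_isomorphic_max_nilp\<close>).

  Conversely, an isomorphism between two displayed algebras preserves the subspaces spanned by
  \<open>e\<^sub>i, \<dots>, e\<^sub>n\<close>, since these form the upper annihilating series. It is therefore triangular. The
  relations \<open>e\<^sub>i e\<^sub>j = 0\<close> together with the linear independence of the squares of
  \<open>e\<^sub>1, \<dots>, e\<^sub>n\<^sub>-\<^sub>1\<close> make it diagonal up to multiples of \<open>e\<^sub>n\<close>, and such a map relates the two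
  matrices by a rescaling (\<open>isomorphic_max_nilp_rescaled\<close>). So isomorphism of displayed algebras
  is rescaling of their matrices. Each rescaling class contains a matrix in which some non-zero
  parameter is 1, by extracting a complex root (\<open>max_nilp_rescaled_normalized\<close>), and \<open>S\<close> picks
  one such matrix from each class.
\<close>

section \<open>Homomorphisms and powers of algebras\<close>

text \<open>
  The witness in \<open>isomorphic_alg\<close> is constrained only on the carrier, so linearity over finite sums
  and the inverse have to be established relative to carriers.
\<close>

definition alg_iso ::
    "('a \<Rightarrow> 'b) \<Rightarrow> ('k::field, 'a::ab_group_add) alg \<Rightarrow> ('k, 'b::ab_group_add) alg \<Rightarrow> bool" where
  "alg_iso f E F \<longleftrightarrow> bij_betw f (carrier E) (carrier F) \<and>
       (\<forall>x\<in>carrier E. \<forall>y\<in>carrier E. f (x + y) = f x + f y) \<and>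
       (\<forall>a. \<forall>x\<in>carrier E. f (scale E a x) = scale F a (f x)) \<and>
       (\<forall>x\<in>carrier E. \<forall>y\<in>carrier E. f (mult E x y) = mult F (f x) (f y))"

lemma isomorphic_alg_iff: "isomorphic_alg E F \<longleftrightarrow> (\<exists>f. alg_iso f E F)"
  by (simp add: isomorphic_alg_def alg_iso_def)

lemma is_algebra_vector_space: "is_algebra E \<Longrightarrow> vector_space (scale E)"
  by (simp add: is_algebra_def)

lemma is_algebra_module: "is_algebra E \<Longrightarrow> module (scale E)"
  using is_algebra_vector_space module_iff_vector_space by blast

lemma carrier_subspace: "is_algebra E \<Longrightarrow> module.subspace (scale E) (carrier E)"
  by (simp add: is_algebra_def)

lemma carrier_zero: "is_algebra E \<Longrightarrow> 0 \<in> carrier E"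
  by (meson carrier_subspace is_algebra_module module.subspace_0)

lemma carrier_add: "is_algebra E \<Longrightarrow> x \<in> carrier E \<Longrightarrow> y \<in> carrier E \<Longrightarrow> x + y \<in> carrier E"
  by (meson carrier_subspace is_algebra_module module.subspace_add)

lemma carrier_scale: "is_algebra E \<Longrightarrow> x \<in> carrier E \<Longrightarrow> scale E a x \<in> carrier E"
  by (meson carrier_subspace is_algebra_module module.subspace_scale)

lemma carrier_mult: "is_algebra E \<Longrightarrow> x \<in> carrier E \<Longrightarrow> y \<in> carrier E \<Longrightarrow> mult E x y \<in> carrier E"
  by (simp add: is_algebra_def)

lemma carrier_sum:
  "is_algebra E \<Longrightarrow> (\<And>i. i \<in> I \<Longrightarrow> x i \<in> carrier E) \<Longrightarrow> sum x I \<in> carrier E"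
  by (meson carrier_subspace is_algebra_module module.subspace_sum)

lemma mult_zero_left: "is_algebra E \<Longrightarrow> y \<in> carrier E \<Longrightarrow> mult E 0 y = 0"
  using carrier_zero[of E] unfolding is_algebra_def
  by (metis add_cancel_right_left)

lemma mult_zero_right: "is_algebra E \<Longrightarrow> y \<in> carrier E \<Longrightarrow> mult E y 0 = 0"
  using carrier_zero[of E] unfolding is_algebra_def
  by (metis add_cancel_right_left)

lemma mult_scale_left:
  "is_algebra E \<Longrightarrow> x \<in> carrier E \<Longrightarrow> y \<in> carrier E \<Longrightarrow>
    mult E (scale E a x) y = scale E a (mult E x y)"
  by (simp add: is_algebra_def)

lemma mult_scale_right:
  "is_algebra E \<Longrightarrow> x \<in> carrier E \<Longrightarrow> y \<in> carrier E \<Longrightarrow>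
    mult E x (scale E a y) = scale E a (mult E x y)"
  by (simp add: is_algebra_def)

lemma mult_sum_left:
  assumes "is_algebra E" "finite I" "\<And>i. i \<in> I \<Longrightarrow> x i \<in> carrier E" "y \<in> carrier E"
  shows "mult E (sum x I) y = (\<Sum>i\<in>I. mult E (x i) y)"
  using assms(2,3)
proof (induction I rule: finite_induct)
  case empty
  then show ?case using assms mult_zero_left by simp
next
  case (insert i I)
  have "sum x I \<in> carrier E" using insert.prems by (intro carrier_sum[OF assms(1)]) auto
  then have "mult E (x i + sum x I) y = mult E (x i) y + mult E (sum x I) y"
    using assms(1,4) insert.prems unfolding is_algebra_def by blast
  then show ?case using insert by simp
qed

lemma mult_sum_right:
  assumes "is_algebra E" "finite I" "\<And>i. i \<in> I \<Longrightarrow> x i \<in> carrier E" "y \<in> carrier E"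
  shows "mult E y (sum x I) = (\<Sum>i\<in>I. mult E y (x i))"
  using assms(2,3)
proof (induction I rule: finite_induct)
  case empty
  then show ?case using assms mult_zero_right by simp
next
  case (insert i I)
  have "sum x I \<in> carrier E" using insert.prems by (intro carrier_sum[OF assms(1)]) auto
  then have "mult E y (x i + sum x I) = mult E y (x i) + mult E y (sum x I)"
    using assms(1,4) insert.prems unfolding is_algebra_def by blast
  then show ?case using insert by simp
qed

lemma alg_iso_zero:
  assumes "is_algebra E" "alg_iso f E F"
  shows "f 0 = 0"
  using assms(2) carrier_zero[OF assms(1)] unfolding alg_iso_def
  by (metis add_cancel_right_left)

lemma alg_iso_sum:
  assumes "is_algebra E" "alg_iso f E F" "finite I" "\<And>i. i \<in> I \<Longrightarrow> x i \<in> carrier E"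
  shows "f (sum x I) = (\<Sum>i\<in>I. f (x i))"
  using assms(3,4)
proof (induction I rule: finite_induct)
  case empty
  then show ?case using assms alg_iso_zero by auto
next
  case (insert i I)
  have "sum x I \<in> carrier E" using insert.prems by (intro carrier_sum[OF assms(1)]) auto
  then have "f (x i + sum x I) = f (x i) + f (sum x I)"
    using assms(2) insert.prems unfolding alg_iso_def by blast
  then show ?case using insert by simp
qed

lemma alg_iso_inv:
  assumes E: "is_algebra E" and f: "alg_iso f E F"
  shows "alg_iso (inv_into (carrier E) f) F E"
proof -
  let ?g = "inv_into (carrier E) f"
  have bij: "bij_betw f (carrier E) (carrier F)" using f by (simp add: alg_iso_def)
  have gf: "?g (f x) = x" if "x \<in> carrier E" for x
    using bij that by (simp add: bij_betw_inv_into_left)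
  have ex: "\<exists>x\<in>carrier E. y = f x" if "y \<in> carrier F" for y
    using bij that by (auto simp: bij_betw_def)
  show ?thesis
    unfolding alg_iso_def
  proof (intro conjI ballI allI)
    show "bij_betw ?g (carrier F) (carrier E)" using bij by (rule bij_betw_inv_into)
  next
    fix x y assume "x \<in> carrier F" "y \<in> carrier F"
    then obtain u v where uv: "u \<in> carrier E" "v \<in> carrier E" "x = f u" "y = f v" using ex by metis
    then have "x + y = f (u + v)" using f by (simp add: alg_iso_def)
    then show "?g (x + y) = ?g x + ?g y"
      using uv by (simp add: gf carrier_add[OF E])
    have "mult F x y = f (mult E u v)" using uv f by (simp add: alg_iso_def)
    then show "?g (mult F x y) = mult E (?g x) (?g y)"
      using uv by (simp add: gf carrier_mult[OF E])
  next
    fix a x assume "x \<in> carrier F"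
    then obtain u where u: "u \<in> carrier E" "x = f u" using ex by metis
    then have "scale F a x = f (scale E a u)" using f by (simp add: alg_iso_def)
    then show "?g (scale F a x) = scale E a (?g x)"
      using u by (simp add: gf carrier_scale[OF E])
  qed
qed

lemma isomorphic_alg_trans:
  assumes "isomorphic_alg E F" "isomorphic_alg F G"
  shows "isomorphic_alg E G"
proof -
  obtain f g where f: "alg_iso f E F" and g: "alg_iso g F G"
    using assms unfolding isomorphic_alg_iff by blast
  have "f x \<in> carrier F" if "x \<in> carrier E" for x
    using f that by (auto simp: alg_iso_def bij_betw_def)
  moreover have "bij_betw (g \<circ> f) (carrier E) (carrier G)"
    using f g bij_betw_trans unfolding alg_iso_def by blast
  ultimately have "alg_iso (g \<circ> f) E G"
    using f g by (simp add: alg_iso_def)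
  then show ?thesis unfolding isomorphic_alg_iff by blast
qed

lemma alg_power_1: "alg_power E (Suc 0) = carrier E"
  by (simp add: alg_power.simps)

text \<open>
  The powers form the smallest multiplicative filtration of the algebra, so every other
  filtration bounds them from above. This is the only way in which upper bounds for the powers
  are obtained below.
\<close>

lemma alg_power_subset_filtration:
  assumes E: "is_algebra E"
    and sub: "\<And>k. k \<ge> 1 \<Longrightarrow> module.subspace (scale E) (G k)"
    and one: "carrier E \<subseteq> G 1"
    and mult: "\<And>i j x y. i \<ge> 1 \<Longrightarrow> j \<ge> 1 \<Longrightarrow> x \<in> G i \<Longrightarrow> y \<in> G j \<Longrightarrow>
      x \<in> carrier E \<Longrightarrow> y \<in> carrier E \<Longrightarrow> mult E x y \<in> G (i + j)"
    and k: "k \<ge> 1"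
  shows "alg_power E k \<subseteq> G k \<inter> carrier E"
  using k
proof (induction k rule: less_induct)
  case (less k)
  interpret V: vector_space "scale E" using E by (rule is_algebra_vector_space)
  have sub': "V.subspace (G k \<inter> carrier E)" if "k \<ge> 1" for k
    using sub[OF that] carrier_subspace[OF E] by (rule V.subspace_inter)
  show ?case
  proof (cases "k \<le> 1")
    case True
    then have "k = 1" using less.prems by simp
    then show ?thesis using one by (simp add: alg_power_1)
  next
    case False
    have "subspace_prod E (alg_power E i) (alg_power E (k - i)) \<subseteq> G k \<inter> carrier E"
      if i: "i \<in> {1..<k}" for i
      unfolding subspace_prod_def
    proof (rule V.span_minimal)
      have ik: "1 \<le> i" "i < k" "1 \<le> k - i" "k - i < k" using i by auto
      have "alg_power E i \<subseteq> G i \<inter> carrier E" by (rule less.IH) (fact ik)+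
      moreover have "alg_power E (k - i) \<subseteq> G (k - i) \<inter> carrier E" by (rule less.IH) (fact ik)+
      ultimately have "mult E u w \<in> G k \<inter> carrier E"
        if "u \<in> alg_power E i" "w \<in> alg_power E (k - i)" for u w
        using mult[OF ik(1,3), of u w] ik(2) carrier_mult[OF E, of u w] that by auto
      then show "{mult E u w |u w. u \<in> alg_power E i \<and> w \<in> alg_power E (k - i)} \<subseteq> G k \<inter> carrier E"
        by blast
      show "V.subspace (G k \<inter> carrier E)" using sub' less.prems by blast
    qed
    then have "V.span (\<Union>i\<in>{1..<k}. subspace_prod E (alg_power E i) (alg_power E (k - i)))
        \<subseteq> G k \<inter> carrier E"
      by (intro V.span_minimal UN_least sub' less.prems)
    then show ?thesis using False by (subst alg_power.simps) simp
  qed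
qed

lemma alg_power_subspace:
  assumes "is_algebra E"
  shows "module.subspace (scale E) (alg_power E k)"
proof -
  interpret V: vector_space "scale E" using assms by (rule is_algebra_vector_space)
  show ?thesis
    using carrier_subspace[OF assms] V.subspace_span by (subst alg_power.simps) simp
qed

lemma alg_power_mult:
  assumes "is_algebra E" "i \<ge> 1" "j \<ge> 1" "x \<in> alg_power E i" "y \<in> alg_power E j"
  shows "mult E x y \<in> alg_power E (i + j)"
proof -
  interpret V: vector_space "scale E" using assms(1) by (rule is_algebra_vector_space)
  have "mult E x y \<in> subspace_prod E (alg_power E i) (alg_power E (i + j - i))"
    unfolding subspace_prod_def using assms(4,5) by (intro V.span_base) auto
  then have "mult E x y \<in>
      V.span (\<Union>l\<in>{1..<i + j}. subspace_prod E (alg_power E l) (alg_power E (i + j - l)))"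
    using assms(2,3) by (intro V.span_base UN_I[of i]) auto
  then show ?thesis using assms(2,3) by (subst alg_power.simps) simp
qed

lemma alg_power_subset_carrier:
  assumes "is_algebra E" "k \<ge> 1"
  shows "alg_power E k \<subseteq> carrier E"
  using alg_power_subset_filtration[OF assms(1), where G = "\<lambda>_. carrier E" and k = k]
    carrier_subspace[OF assms(1)] carrier_mult[OF assms(1)] assms(2) by auto

text \<open>
  The preimages of the powers of the target form a filtration of the source, which therefore
  contains the powers of the source.
\<close>

lemma alg_iso_power:
  assumes E: "is_algebra E" and F: "is_algebra F" and f: "alg_iso f E F" and k: "k \<ge> 1"
  shows "f ` alg_power E k \<subseteq> alg_power F k"
proof -
  interpret V: vector_space "scale E" using E by (rule is_algebra_vector_space)
  interpret W: vector_space "scale F" using F by (rule is_algebra_vector_space)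
  define G where "G m = {x \<in> carrier E. f x \<in> alg_power F m}" for m
  have "alg_power E k \<subseteq> G k \<inter> carrier E"
  proof (rule alg_power_subset_filtration[OF E _ _ _ k])
    fix m :: nat
    have "W.subspace (alg_power F m)" by (rule alg_power_subspace[OF F])
    then show "V.subspace (G m)"
      using f carrier_zero[OF E] carrier_add[OF E] carrier_scale[OF E] alg_iso_zero[OF E f]
      by (auto simp: G_def V.subspace_def W.subspace_def alg_iso_def)
  next
    show "carrier E \<subseteq> G 1"
      using f by (auto simp: G_def alg_power_1 alg_iso_def bij_betw_def)
  next
    fix i j :: nat and x y
    assume "i \<ge> 1" "j \<ge> 1" "x \<in> G i" "y \<in> G j" "x \<in> carrier E" "y \<in> carrier E"
    then show "mult E x y \<in> G (i + j)"
      using f carrier_mult[OF E] alg_power_mult[OF F] by (auto simp: G_def alg_iso_def)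
  qed
  then show ?thesis by (auto simp: G_def)
qed

text \<open>
  Powers are defined by the algebra structure alone, so nilpotency and its index can be read off
  in coordinates.
\<close>

lemma alg_iso_power_zero:
  assumes E: "is_algebra E" and F: "is_algebra F" and f: "alg_iso f E F" and k: "k \<ge> 1"
    and z: "alg_power F k = {0}"
  shows "alg_power E k = {0}"
proof -
  interpret V: vector_space "scale E" using E by (rule is_algebra_vector_space)
  have "x = 0" if "x \<in> alg_power E k" for x
  proof (rule inj_onD[of f "carrier E"])
    show "inj_on f (carrier E)" using f by (auto simp: alg_iso_def bij_betw_def)
    show "f x = f 0" using alg_iso_power[OF E F f k] that z alg_iso_zero[OF E f] by auto
    show "x \<in> carrier E" using that alg_power_subset_carrier[OF E k] by blast
    show "0 \<in> carrier E" by (rule carrier_zero[OF E])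
  qed
  moreover have "0 \<in> alg_power E k" using alg_power_subspace[OF E] V.subspace_0 by blast
  ultimately show ?thesis by blast
qed

lemma isomorphic_alg_power_zero_iff:
  assumes "is_algebra E" "is_algebra F" "isomorphic_alg E F" "k \<ge> 1"
  shows "alg_power E k = {0} \<longleftrightarrow> alg_power F k = {0}"
proof -
  obtain f where f: "alg_iso f E F" using assms(3) unfolding isomorphic_alg_iff by blast
  show ?thesis
    using alg_iso_power_zero[OF assms(1,2) f assms(4)]
      alg_iso_power_zero[OF assms(2,1) alg_iso_inv[OF assms(1) f] assms(4)] by blast
qed

section \<open>Evolution algebras in coordinates\<close>

lemma evo_carrier: "carrier (evo_alg n A) = {v. \<forall>i. i \<notin> {1..n} \<longrightarrow> v i = 0}"
  by (simp add: evo_alg_def)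

lemma evo_scale: "scale (evo_alg n A) a v = (\<lambda>i. a * v i)"
  by (simp add: evo_alg_def)

lemma evo_mult:
  "mult (evo_alg n A) u v = (\<lambda>k. if k \<in> {1..n} then \<Sum>i=1..n. u i * v i * A i k else 0)"
  by (simp add: evo_alg_def)

lemma unit_vec_carrier: "i \<in> {1..n} \<Longrightarrow> unit_vec i \<in> carrier (evo_alg n A)"
  by (auto simp: evo_carrier unit_vec_def)

lemma sum_unit_vec:
  fixes f :: "nat \<Rightarrow> 'k::field"
  assumes "i \<in> {1..n}"
  shows "(\<Sum>k=1..n. f k * unit_vec i k * g k) = f i * g i"
proof -
  have "(\<Sum>k=1..n. f k * unit_vec i k * g k) = (\<Sum>k=1..n. if k = i then f i * g i else 0)"
    by (intro sum.cong) (auto simp: unit_vec_def)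
  then show ?thesis using assms by simp
qed

lemma mult_unit_vec_right:
  assumes "i \<in> {1..n}"
  shows "mult (evo_alg n A) v (unit_vec i) = (\<lambda>k. if k \<in> {1..n} then v i * A i k else 0)"
  unfolding evo_mult using sum_unit_vec[OF assms, of v] by (intro ext) auto

lemma sum_fun_apply: "(sum g I) x = (\<Sum>i\<in>I. g i x)" for g :: "'i \<Rightarrow> 'b \<Rightarrow> 'c::comm_monoid_add"
  by (induction I rule: infinite_finite_induct) auto

text \<open>
  An isomorphism between coordinate algebras is given by a matrix, whose rows are the images of
  the unit vectors.
\<close>

lemma alg_iso_evo_expand:
  assumes f: "alg_iso f (evo_alg n A) (evo_alg m B)" and v: "v \<in> carrier (evo_alg n A)"
  shows "f v k = (\<Sum>j=1..n. v j * f (unit_vec j) k)"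
proof -
  have "v = (\<Sum>j=1..n. scale (evo_alg n A) (v j) (unit_vec j))"
  proof
    fix k
    have "(\<Sum>j=1..n. v j * unit_vec j k) = (\<Sum>j=1..n. if j = k then v k else 0)"
      by (intro sum.cong) (auto simp: unit_vec_def)
    then show "v k = (\<Sum>j=1..n. scale (evo_alg n A) (v j) (unit_vec j)) k"
      using v by (auto simp: sum_fun_apply evo_scale evo_carrier)
  qed
  then have "f v = f (\<Sum>j=1..n. scale (evo_alg n A) (v j) (unit_vec j))" by simp
  also have "\<dots> = (\<Sum>j=1..n. f (scale (evo_alg n A) (v j) (unit_vec j)))"
    by (intro alg_iso_sum[OF is_algebra_evo_alg f])
      (auto intro!: carrier_scale[OF is_algebra_evo_alg] unit_vec_carrier)
  also have "\<dots> = (\<Sum>j=1..n. scale (evo_alg m B) (v j) (f (unit_vec j)))"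
    using f by (intro sum.cong) (simp_all add: alg_iso_def unit_vec_carrier)
  finally show ?thesis by (simp add: sum_fun_apply evo_scale)
qed

lemma natural_basis_card:
  assumes E: "is_algebra E" and B: "natural_basis E B" and "alg_dim E = n" "n \<ge> 1"
  shows "finite B" "card B = n"
proof -
  interpret V: vector_space "scale E" using E by (rule is_algebra_vector_space)
  have "V.dim (carrier E) = card B"
    using B V.dim_span_eq_card_independent[of B] by (simp add: natural_basis_def)
  then show "card B = n" using assms(3) by (simp add: alg_dim_def)
  then show "finite B" using assms(4) card_ge_0_finite by force
qed

text \<open>
  Any enumeration \<open>e\<close> of the basis gives coordinates. Row \<open>i\<close> of the structure matrix is the
  coordinate vector of \<open>e\<^sub>i e\<^sub>i\<close>.
\<close>

lemma natural_basis_isomorphic_evo_alg: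
  assumes E: "is_algebra E" and B: "natural_basis E B" and fin: "finite B" and card: "card B = n"
  shows "\<exists>A. isomorphic_alg E (evo_alg n A)"
proof -
  interpret V: vector_space "scale E" using E by (rule is_algebra_vector_space)
  obtain e where e: "bij_betw e {1..n} B"
    using ex_bij_betw_nat_finite_1[OF fin] card by blast
  have span: "V.span B = carrier E" and indep: "\<not> V.dependent B"
    and orth: "\<And>x y. x \<in> B \<Longrightarrow> y \<in> B \<Longrightarrow> x \<noteq> y \<Longrightarrow> mult E x y = 0"
    using B by (auto simp: natural_basis_def)
  have eB: "e i \<in> B" if "i \<in> {1..n}" for i using e that by (auto simp: bij_betw_def)
  then have eE: "e i \<in> carrier E" if "i \<in> {1..n}" for i using that V.span_base span by blast
  \<comment> \<open>The linear combination map; its inverse assigns coordinates.\<close>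
  define g where "g v = (\<Sum>i=1..n. scale E (v i) (e i))" for v
  define K where "K = {v :: nat \<Rightarrow> 'a. \<forall>i. i \<notin> {1..n} \<longrightarrow> v i = 0}"
  have gE: "g v \<in> carrier E" for v
    unfolding g_def by (intro carrier_sum[OF E] carrier_scale[OF E] eE)
  have g_add: "g (u + v) = g u + g v" for u v
    by (simp add: g_def V.scale_left_distrib sum.distrib)
  have g_scale: "g (\<lambda>i. a * v i) = scale E a (g v)" for a v
    by (simp add: g_def V.scale_sum_right)
  have g_surj: "\<exists>v\<in>K. g v = x" if x: "x \<in> carrier E" for x
  proof -
    obtain u where u: "x = (\<Sum>b\<in>B. scale E (u b) b)"
      using x span V.span_finite[OF fin] by auto
    have "x = (\<Sum>i=1..n. scale E (u (e i)) (e i))"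
      unfolding u by (rule sum.reindex_bij_betw[OF e, symmetric])
    then have "g (\<lambda>i. if i \<in> {1..n} then u (e i) else 0) = x"
      by (simp add: g_def)
    then show ?thesis unfolding K_def by (intro bexI) auto
  qed
  have g_ker: "v i = 0" if v: "g v = 0" and i: "i \<in> {1..n}" for v i
  proof -
    let ?u = "\<lambda>b. v (inv_into {1..n} e b)"
    have inv: "inv_into {1..n} e (e j) = j" if "j \<in> {1..n}" for j
      using e that by (rule bij_betw_inv_into_left)
    have "(\<Sum>b\<in>B. scale E (?u b) b) = (\<Sum>j=1..n. scale E (?u (e j)) (e j))"
      by (rule sum.reindex_bij_betw[OF e, symmetric])
    also have "\<dots> = g v" unfolding g_def by (intro sum.cong refl) (simp only: inv)
    finally have "(\<Sum>b\<in>B. scale E (?u b) b) = 0" using v by simp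
    then have "?u (e i) = 0"
      by (rule V.independentD[OF indep fin order_refl _ eB[OF i]])
    then show ?thesis using inv[OF i] by simp
  qed
  have g_inj: "inj_on g K"
  proof (rule inj_onI)
    fix u v assume uv: "u \<in> K" "v \<in> K" "g u = g v"
    have "g (u - v) = 0"
      using g_add[of "u - v" v] uv(3) by simp
    then have "u i = v i" if "i \<in> {1..n}" for i using g_ker[of "u - v" i] that by simp
    moreover have "u i = v i" if "i \<notin> {1..n}" for i using uv(1,2) that unfolding K_def by simp
    ultimately show "u = v" by (intro ext) blast
  qed
  have "\<forall>i\<in>{1..n}. \<exists>v. g v = mult E (e i) (e i)"
    using g_surj carrier_mult[OF E eE eE] by blast
  then obtain A where A: "\<And>i. i \<in> {1..n} \<Longrightarrow> g (A i) = mult E (e i) (e i)"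
    by metis
  have carr: "carrier (evo_alg n A) = K" by (simp add: evo_carrier K_def)
  have g_mult: "g (mult (evo_alg n A) u v) = mult E (g u) (g v)" for u v
  proof -
    have row: "mult E (scale E (u i) (e i)) (g v) = scale E (u i * v i) (g (A i))"
      if i: "i \<in> {1..n}" for i
    proof -
      have "mult E (scale E (u i) (e i)) (g v) =
          (\<Sum>j=1..n. mult E (scale E (u i) (e i)) (scale E (v j) (e j)))"
        unfolding g_def using i
        by (intro mult_sum_right[OF E]) (auto intro!: carrier_scale[OF E] eE)
      also have "\<dots> = (\<Sum>j=1..n. if j = i then scale E (u i * v i) (mult E (e i) (e i)) else 0)"
      proof (intro sum.cong refl)
        fix j assume j: "j \<in> {1..n}"
        have "mult E (scale E (u i) (e i)) (scale E (v j) (e j)) =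
            scale E (u i * v j) (mult E (e i) (e j))"
          by (simp only: mult_scale_left[OF E eE[OF i] carrier_scale[OF E eE[OF j]]]
              mult_scale_right[OF E eE[OF i] eE[OF j]] V.scale_scale)
        moreover have "mult E (e i) (e j) = 0" if "j \<noteq> i"
        proof -
          have "e i \<noteq> e j" using bij_betw_imp_inj_on[OF e] i j that by (metis inj_onD)
          then show ?thesis by (rule orth[OF eB[OF i] eB[OF j]])
        qed
        ultimately show "mult E (scale E (u i) (e i)) (scale E (v j) (e j)) =
            (if j = i then scale E (u i * v i) (mult E (e i) (e i)) else 0)"
          by auto
      qed
      finally show ?thesis using i A by simp
    qed
    have "mult E (g u) (g v) = (\<Sum>i=1..n. mult E (scale E (u i) (e i)) (g v))"
      unfolding g_def[of u]
      by (intro mult_sum_left[OF E]) (auto intro!: carrier_scale[OF E] eE gE)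
    also have "\<dots> = (\<Sum>i=1..n. \<Sum>j=1..n. scale E (u i * v i * A i j) (e j))"
      using row by (intro sum.cong) (auto simp: g_def V.scale_sum_right)
    also have "\<dots> = (\<Sum>j=1..n. \<Sum>i=1..n. scale E (u i * v i * A i j) (e j))"
      by (rule sum.swap)
    also have "\<dots> = g (mult (evo_alg n A) u v)"
      unfolding g_def evo_mult by (intro sum.cong) (auto simp: V.scale_sum_left)
    finally show ?thesis by simp
  qed
  have "bij_betw g K (carrier E)"
    unfolding bij_betw_def using g_inj g_surj gE by blast
  then have "alg_iso g (evo_alg n A) E"
    unfolding alg_iso_def carr evo_scale using g_add g_scale g_mult by blast
  then show ?thesis
    using alg_iso_inv[OF is_algebra_evo_alg] unfolding isomorphic_alg_iff by blast
qed

section \<open>Changes of the natural basis\<close>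

lemma evo_alg_permute:
  assumes p: "bij_betw p {1..n} {1..n}"
  shows "isomorphic_alg (evo_alg n A) (evo_alg n (\<lambda>i j. A (p i) (p j)))"
proof -
  let ?f = "\<lambda>v k. if k \<in> {1..n} then v (p k) else 0"
  let ?q = "inv_into {1..n} p"
  let ?g = "\<lambda>v k. if k \<in> {1..n} then v (?q k) else 0"
  let ?K = "{v :: nat \<Rightarrow> 'a. \<forall>i. i \<notin> {1..n} \<longrightarrow> v i = 0}"
  have pn: "p k \<in> {1..n}" if "k \<in> {1..n}" for k using p that by (auto simp: bij_betw_def)
  have qn: "?q k \<in> {1..n}" if "k \<in> {1..n}" for k
    using bij_betw_inv_into[OF p] that by (auto simp: bij_betw_def)
  have qp: "?q (p k) = k" if "k \<in> {1..n}" for k using p that by (rule bij_betw_inv_into_left)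
  have pq: "p (?q k) = k" if "k \<in> {1..n}" for k using p that by (rule bij_betw_inv_into_right)
  have "bij_betw ?f ?K ?K"
    by (rule bij_betw_byWitness[where f' = ?g])
      (use pn qn qp pq in \<open>auto simp: fun_eq_iff\<close>)
  moreover have "(\<Sum>i=1..n. u (p i) * v (p i) * A (p i) (p k)) = (\<Sum>i=1..n. u i * v i * A i (p k))"
    for u v k by (rule sum.reindex_bij_betw[OF p])
  ultimately have "alg_iso ?f (evo_alg n A) (evo_alg n (\<lambda>i j. A (p i) (p j)))"
    unfolding alg_iso_def evo_carrier evo_scale evo_mult
    using pn by (auto simp: fun_eq_iff simp del: atLeastAtMost_iff)
  then show ?thesis unfolding isomorphic_alg_iff by blast
qed

text \<open>
  A vector with coordinates \<open>v\<^sub>k\<close> in the basis \<open>e\<^sub>k\<close> has coordinates \<open>v\<^sub>k / c\<^sub>k\<close> in the basis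
  \<open>c\<^sub>k e\<^sub>k\<close>.
\<close>

lemma evo_alg_rescaled:
  assumes "rescaled n A B"
  shows "isomorphic_alg (evo_alg n A) (evo_alg n B)"
proof -
  obtain c where c: "\<And>i. i \<in> {1..n} \<Longrightarrow> c i \<noteq> 0"
    and B: "\<And>i j. i \<in> {1..n} \<Longrightarrow> j \<in> {1..n} \<Longrightarrow> B i j = (c i)\<^sup>2 / c j * A i j"
    using assms unfolding rescaled_def by blast
  let ?f = "\<lambda>v k. v k / c k" and ?g = "\<lambda>v k. v k * c k"
  let ?K = "{v :: nat \<Rightarrow> complex. \<forall>i. i \<notin> {1..n} \<longrightarrow> v i = 0}"
  have "v k / c k * c k = v k" if "v \<in> ?K" for v k
    using that c by (cases "k \<in> {1..n}") auto
  moreover have "v k * c k / c k = v k" if "v \<in> ?K" for v k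
    using that c by (cases "k \<in> {1..n}") auto
  ultimately have "bij_betw ?f ?K ?K"
    by (intro bij_betw_byWitness[where f' = ?g]) (auto simp: fun_eq_iff)
  moreover have "(\<Sum>i=1..n. u i * v i * A i k) / c k =
      (\<Sum>i=1..n. u i / c i * (v i / c i) * B i k)" if "k \<in> {1..n}" for u v k
    unfolding sum_divide_distrib
    using that c by (intro sum.cong) (auto simp: B power2_eq_square)
  ultimately have "alg_iso ?f (evo_alg n A) (evo_alg n B)"
    unfolding alg_iso_def evo_carrier evo_scale evo_mult
    by (auto simp: fun_eq_iff add_divide_distrib simp del: atLeastAtMost_iff)
  then show ?thesis unfolding isomorphic_alg_iff by blast
qed

text \<open>
  This is the change of natural basis from \<open>e\<^sub>i\<close> to \<open>e\<^sub>i + b\<^sub>i e\<^sub>n\<close> for \<open>i < n\<close>. As \<open>e\<^sub>n\<close> has square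
  zero and is orthogonal to the other basis vectors, products of the new basis vectors equal
  those of the old ones; re-expanding the squares in the new basis changes only the coefficient
  of \<open>e\<^sub>n\<close>.
\<close>

lemma evo_alg_shear:
  fixes A :: "nat \<Rightarrow> nat \<Rightarrow> 'k::field"
  assumes n: "n \<ge> 1" and last: "\<And>j. j \<in> {1..n} \<Longrightarrow> A n j = 0"
    and B: "\<And>i j. B i j = (if j = n then A i n - (\<Sum>l=1..<n. A i l * b l) else A i j)"
  shows "isomorphic_alg (evo_alg n A) (evo_alg n B)"
proof -
  let ?K = "{v :: nat \<Rightarrow> 'k. \<forall>i. i \<notin> {1..n} \<longrightarrow> v i = 0}"
  define s where "s v = (\<Sum>l=1..<n. v l * b l)" for v :: "nat \<Rightarrow> 'k"
  let ?f = "\<lambda>v k. if k = n then v n - s v else v k"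
  let ?g = "\<lambda>v k. if k = n then v n + s v else v k"
  have s_upd: "s (\<lambda>k. if k = n then x else v k) = s v" for v x
    unfolding s_def by (intro sum.cong) auto
  have "bij_betw ?f ?K ?K"
    by (rule bij_betw_byWitness[where f' = ?g]) (use n in \<open>auto simp: s_upd\<close>)
  moreover have s_add: "s (u + v) = s u + s v" for u v
    by (simp add: s_def algebra_simps sum.distrib)
  moreover have s_scale: "s (\<lambda>i. a * v i) = a * s v" for a v
    by (simp add: s_def sum_distrib_left mult.assoc)
  moreover have "?f (mult (evo_alg n A) u v) = mult (evo_alg n B) (?f u) (?f v)" for u v
  proof
    fix k
    have rhs: "(\<Sum>i=1..n. ?f u i * ?f v i * B i k) = (\<Sum>i=1..n. u i * v i * B i k)"
      if "k \<in> {1..n}" for k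
      using that last by (intro sum.cong) (auto simp: B)
    show "?f (mult (evo_alg n A) u v) k = mult (evo_alg n B) (?f u) (?f v) k"
    proof (cases "k = n")
      case True
      have "s (mult (evo_alg n A) u v) = (\<Sum>l=1..<n. \<Sum>i=1..n. u i * v i * (A i l * b l))"
        unfolding s_def evo_mult
        by (intro sum.cong) (auto simp: sum_distrib_right mult.assoc)
      also have "\<dots> = (\<Sum>i=1..n. \<Sum>l=1..<n. u i * v i * (A i l * b l))"
        by (rule sum.swap)
      also have "\<dots> = (\<Sum>i=1..n. u i * v i * (\<Sum>l=1..<n. A i l * b l))"
        by (simp add: sum_distrib_left)
      finally have "(\<Sum>i=1..n. u i * v i * A i n) - s (mult (evo_alg n A) u v) =
          (\<Sum>i=1..n. u i * v i * B i n)"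
        by (simp add: B right_diff_distrib sum_subtractf)
      then show ?thesis using True n rhs[of n] by (simp add: evo_mult)
    next
      case False
      then have "(\<Sum>i=1..n. u i * v i * A i k) = (\<Sum>i=1..n. u i * v i * B i k)"
        by (simp add: B)
      then show ?thesis using False rhs[of k] by (simp add: evo_mult)
    qed
  qed
  ultimately have "alg_iso ?f (evo_alg n A) (evo_alg n B)"
    unfolding alg_iso_def evo_carrier evo_scale
    by (auto simp: fun_eq_iff right_diff_distrib)
  then show ?thesis unfolding isomorphic_alg_iff by blast
qed

section \<open>Triangular form of nilpotent evolution algebras\<close>

text \<open>
  Suppose each \<open>i\<close> outside \<open>C\<close> has some \<open>j\<close> outside \<open>C\<close> with \<open>A i j \<noteq> 0\<close>. If \<open>y\<close> lies in
  the power \<open>E\<^sup>m\<close> and has a non-zero coordinate at \<open>j\<close> outside \<open>C\<close>, then \<open>y e\<^sub>j\<close> lies in the next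
  power and is a non-zero multiple of the square of \<open>e\<^sub>j\<close>, which again has a non-zero coordinate
  outside \<open>C\<close>. So no power is zero.
\<close>

lemma nilpotent_evo_alg_step:
  assumes k: "k \<ge> 1" and z: "alg_power (evo_alg n A) k = {0}"
    and C: "C \<subset> {1..n}"
  shows "\<exists>i\<in>{1..n} - C. \<forall>j\<in>{1..n} - C. A i j = 0"
proof (rule ccontr)
  assume "\<not> ?thesis"
  then have next_idx: "\<exists>j\<in>{1..n} - C. A i j \<noteq> 0" if "i \<in> {1..n} - C" for i using that by blast
  let ?E = "evo_alg n A"
  have "\<exists>y\<in>alg_power ?E m. \<exists>j\<in>{1..n} - C. y j \<noteq> 0" if "m \<ge> 1" for m
    using that
  proof (induction m rule: dec_induct)
    case base
    obtain j where j: "j \<in> {1..n} - C" using C by blast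
    then have "unit_vec j \<in> alg_power ?E 1" by (simp add: alg_power_1 unit_vec_carrier)
    moreover have "unit_vec j j \<noteq> (0 :: 'a)" by (simp add: unit_vec_def)
    ultimately show ?case using j by blast
  next
    case (step m)
    then obtain y j where y: "y \<in> alg_power ?E m" and j: "j \<in> {1..n} - C" "y j \<noteq> 0" by blast
    obtain l where l: "l \<in> {1..n} - C" "A j l \<noteq> 0" using next_idx[OF j(1)] by blast
    have "mult ?E y (unit_vec j) \<in> alg_power ?E (m + 1)"
      using step.hyps y j(1)
      by (intro alg_power_mult[OF is_algebra_evo_alg]) (auto simp: alg_power_1 unit_vec_carrier)
    moreover have "mult ?E y (unit_vec j) l \<noteq> 0"
      using j l mult_unit_vec_right[of j n A y] by simp
    ultimately show ?case using l(1) unfolding Suc_eq_plus1 by blast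
  qed
  then show False using z k by (metis singletonD zero_fun_apply)
qed

text \<open>
  The order is built from its end: each step puts in front an index whose square involves only
  indices already listed. The last conjunct, that the listed indices span an ideal, keeps the
  new index out of the squares of the listed ones.
\<close>

lemma nilpotent_evo_alg_order:
  assumes k: "k \<ge> 1" and z: "alg_power (evo_alg n A) k = {0}" and "m \<le> n"
  shows "\<exists>xs. length xs = m \<and> distinct xs \<and> set xs \<subseteq> {1..n} \<and>
    sorted_wrt (\<lambda>i j. A j i = 0) xs \<and> (\<forall>i\<in>set xs. A i i = 0) \<and>
    (\<forall>i\<in>set xs. \<forall>j\<in>{1..n} - set xs. A i j = 0)"
  using \<open>m \<le> n\<close>
proof (induction m)
  case 0
  then show ?case by simp
next
  case (Suc m)
  then obtain xs where xs: "length xs = m" "distinct xs" "set xs \<subseteq> {1..n}"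
      "sorted_wrt (\<lambda>i j. A j i = 0) xs" "\<forall>i\<in>set xs. A i i = 0"
      "\<forall>i\<in>set xs. \<forall>j\<in>{1..n} - set xs. A i j = 0"
    by auto
  have "set xs \<noteq> {1..n}"
    using xs(1,2) Suc.prems distinct_card[of xs] by auto
  then obtain i where i: "i \<in> {1..n} - set xs" "\<forall>j\<in>{1..n} - set xs. A i j = 0"
    using nilpotent_evo_alg_step[OF k z, of "set xs"] xs(3) by blast
  then show ?case using xs by (intro exI[of _ "i # xs"]) auto
qed

lemma nilpotent_evo_alg_triangular:
  assumes k: "k \<ge> 1" and z: "alg_power (evo_alg n A) k = {0}"
  shows "\<exists>B. isomorphic_alg (evo_alg n A) (evo_alg n B) \<and>
    (\<forall>i\<in>{1..n}. \<forall>j\<in>{1..n}. j \<le> i \<longrightarrow> B i j = 0)"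
proof -
  obtain xs where xs: "length xs = n" "distinct xs" "set xs \<subseteq> {1..n}"
      "sorted_wrt (\<lambda>i j. A j i = 0) xs" "\<forall>i\<in>set xs. A i i = 0"
    using nilpotent_evo_alg_order[OF k z order_refl] by blast
  define p where "p i = xs ! (i - 1)" for i
  have "card (set xs) = n" using xs(1,2) by (simp add: distinct_card)
  then have "set xs = {1..n}" using xs(3) by (intro card_subset_eq) auto
  then have "bij_betw (\<lambda>i. xs ! i) {..<n} {1..n}"
    using bij_betw_nth[OF xs(2), of "{..<n}" "{1..n}"] xs(1) by simp
  moreover have "bij_betw (\<lambda>i. i - 1) {1..n} {..<n}"
    by (rule bij_betw_byWitness[where f' = Suc]) auto
  ultimately have "bij_betw ((\<lambda>i. xs ! i) \<circ> (\<lambda>i. i - 1)) {1..n} {1..n}"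
    by (rule bij_betw_trans[rotated])
  then have p: "bij_betw p {1..n} {1..n}" by (simp add: p_def[abs_def] comp_def)
  have "A (p i) (p j) = 0" if "i \<in> {1..n}" "j \<in> {1..n}" "j \<le> i" for i j
  proof (cases "j = i")
    case True
    then show ?thesis using that xs(1,5) by (auto simp: p_def)
  next
    case False
    then show ?thesis
      using that xs(1) sorted_wrt_nth_less[OF xs(4), of "j - 1" "i - 1"] by (simp add: p_def)
  qed
  then show ?thesis using evo_alg_permute[OF p, of A] by blast
qed

section \<open>Maximal index forces a non-zero superdiagonal\<close>

text \<open>
  Let \<open>G m\<close> be the span of the basis vectors of weight at least \<open>m\<close>. A product of elements of
  \<open>G a\<close> and \<open>G b\<close> only involves squares of basis vectors of weight at least \<open>max a b\<close>, hence lies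
  in weights at least \<open>2 * max a b\<close>, which is at least \<open>a + b\<close>. So \<open>G\<close> is a filtration and
  contains the powers, and \<open>G k = 0\<close> when all weights are below \<open>k\<close>.
\<close>

lemma weighted_evo_alg_power_zero:
  assumes k: "k \<ge> 1" and pos: "\<And>i. i \<in> {1..n} \<Longrightarrow> w i \<ge> (1::nat)"
    and double: "\<And>i j. i \<in> {1..n} \<Longrightarrow> j \<in> {1..n} \<Longrightarrow> A i j \<noteq> 0 \<Longrightarrow> 2 * w i \<le> w j"
    and less: "\<And>i. i \<in> {1..n} \<Longrightarrow> w i < k"
  shows "alg_power (evo_alg n A) k = {0}"
proof -
  let ?E = "evo_alg n A"
  interpret V: vector_space "scale ?E"
    by (rule is_algebra_vector_space[OF is_algebra_evo_alg])
  define G where "G m = {v. \<forall>i\<in>{1..n}. w i < m \<longrightarrow> v i = (0::'a)}" for m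
  have "alg_power ?E k \<subseteq> G k \<inter> carrier ?E"
  proof (rule alg_power_subset_filtration[OF is_algebra_evo_alg _ _ _ k])
    show "V.subspace (G m)" for m by (auto simp: G_def V.subspace_def evo_scale)
    show "carrier ?E \<subseteq> G 1" using pos by (fastforce simp: G_def)
  next
    fix a b :: nat and u v
    assume u: "u \<in> G a" and v: "v \<in> G b"
    have "u i * v i * A i l = 0" if "i \<in> {1..n}" "l \<in> {1..n}" "w l < a + b" for i l
    proof (rule ccontr)
      assume "u i * v i * A i l \<noteq> 0"
      then have "a \<le> w i" "b \<le> w i" "2 * w i \<le> w l"
        using u v that double[of i l] by (force simp: G_def)+
      then show False using that by simp
    qed
    then show "mult ?E u v \<in> G (a + b)" by (auto simp: G_def evo_mult intro!: sum.neutral)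
  qed
  moreover have "v = 0" if "v \<in> G k \<inter> carrier ?E" for v
  proof
    show "v i = 0 i" for i using that less by (cases "i \<in> {1..n}") (auto simp: G_def evo_carrier)
  qed
  moreover have "0 \<in> alg_power ?E k"
    using alg_power_subspace[OF is_algebra_evo_alg] V.subspace_0 by blast
  ultimately show ?thesis by blast
qed

lemma superdiagonal_nonzero:
  assumes upper: "\<And>i j. i \<in> {1..n} \<Longrightarrow> j \<in> {1..n} \<Longrightarrow> j \<le> i \<Longrightarrow> A i j = 0"
    and ne: "alg_power (evo_alg n A) (2 ^ (n - 1)) \<noteq> {0}"
    and i: "1 \<le> i" "i + 1 \<le> n"
  shows "A i (i + 1) \<noteq> 0"
proof
  assume zero: "A i (i + 1) = 0"
  \<comment> \<open>The weights \<open>2\<^sup>j\<^sup>-\<^sup>1\<close>, halved from index \<open>i + 1\<close> on: \<open>e\<^sub>i\<close> and \<open>e\<^sub>i\<^sub>+\<^sub>1\<close> get the same weight,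
    which is harmless because \<open>e\<^sub>i\<^sub>+\<^sub>1\<close> does not occur in the square of \<open>e\<^sub>i\<close>.\<close>
  define w :: "nat \<Rightarrow> nat" where "w j = (if j \<le> i then 2 ^ (j - 1) else 2 ^ (j - 2))" for j
  have "alg_power (evo_alg n A) (2 ^ (n - 1)) = {0}"
  proof (rule weighted_evo_alg_power_zero)
    show "(2::nat) ^ (n - 1) \<ge> 1" by simp
    show "w j \<ge> 1" for j by (simp add: w_def)
    show "w j < 2 ^ (n - 1)" if "j \<in> {1..n}" for j
      using that i by (auto simp: w_def intro!: power_strict_increasing)
  next
    fix l j assume lj: "l \<in> {1..n}" "j \<in> {1..n}" "A l j \<noteq> 0"
    then have "l < j" using upper[of l j] by force
    have two: "2 * 2 ^ (x::nat) \<le> (2::nat) ^ y" if "x < y" for x y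
      using power_increasing[of "Suc x" y "2::nat"] that by simp
    consider "j \<le> i" | "l \<le> i" "j = i + 1" | "l \<le> i" "i + 1 < j" | "i < l" by linarith
    then show "2 * w l \<le> w j"
    proof cases
      case 2
      then have "l < i" using zero lj(3) by (cases "l = i") auto
      then have "l - 1 < i - 1" using lj(1) by auto
      then show ?thesis using 2 two[of "l - 1" "i - 1"] by (simp add: w_def)
    qed (use \<open>l < j\<close> lj i in \<open>auto simp: w_def intro!: two\<close>)
  qed
  then show False using ne by contradiction
qed

section \<open>Reduction to the displayed matrices\<close>

text \<open>
  Back substitution: the equation of row \<open>i\<close> determines \<open>b (i + 1)\<close>, with coefficient
  \<open>A i (i + 1)\<close>, from the later unknowns.
\<close>

lemma last_column_system_solvable:
  fixes A :: "nat \<Rightarrow> nat \<Rightarrow> 'k::field"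
  assumes super: "\<And>i. 1 \<le> i \<Longrightarrow> i + 1 \<le> n \<Longrightarrow> A i (i + 1) \<noteq> 0" and "1 \<le> k" "k \<le> n"
  shows "\<exists>b. \<forall>i. k \<le> i \<longrightarrow> i + 2 \<le> n \<longrightarrow> (\<Sum>l\<in>{i<..<n}. A i l * b l) = A i n"
  using \<open>k \<le> n\<close> \<open>1 \<le> k\<close>
proof (induction k rule: inc_induct)
  case base
  then show ?case by auto
next
  case (step k)
  then obtain b where b:
    "\<And>i. Suc k \<le> i \<Longrightarrow> i + 2 \<le> n \<Longrightarrow> (\<Sum>l\<in>{i<..<n}. A i l * b l) = A i n"
    by auto
  define c where "c = b(Suc k := (A k n - (\<Sum>l\<in>{Suc k<..<n}. A k l * b l)) / A k (k + 1))"
  have cb: "(\<Sum>l\<in>{i<..<n}. A j l * c l) = (\<Sum>l\<in>{i<..<n}. A j l * b l)" if "Suc k \<le> i" for i j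
    using that by (intro sum.cong) (auto simp: c_def)
  have "(\<Sum>l\<in>{k<..<n}. A k l * c l) = A k n" if "k + 2 \<le> n"
  proof -
    have "{k<..<n} = insert (Suc k) {Suc k<..<n}" using that by auto
    then have "(\<Sum>l\<in>{k<..<n}. A k l * c l) =
        A k (k + 1) * c (Suc k) + (\<Sum>l\<in>{Suc k<..<n}. A k l * b l)"
      using cb[of "Suc k" k] by simp
    then show ?thesis using super[of k] step that by (simp add: c_def)
  qed
  then have "\<forall>i. k \<le> i \<longrightarrow> i + 2 \<le> n \<longrightarrow> (\<Sum>l\<in>{i<..<n}. A i l * c l) = A i n"
    using b cb by (metis le_SucE le_antisym not_less_eq_eq)
  then show ?case by blast
qed

lemma triangular_isomorphic_max_nilp:
  fixes A :: "nat \<Rightarrow> nat \<Rightarrow> complex"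
  assumes n: "n \<ge> 1"
    and upper: "\<And>i j. i \<in> {1..n} \<Longrightarrow> j \<in> {1..n} \<Longrightarrow> j \<le> i \<Longrightarrow> A i j = 0"
    and super: "\<And>i. 1 \<le> i \<Longrightarrow> i + 1 \<le> n \<Longrightarrow> A i (i + 1) \<noteq> 0"
  shows "\<exists>B. max_nilp_matrix n B \<and> isomorphic_alg (evo_alg n A) (evo_alg n B)"
proof -
  obtain b where b: "\<And>i. 1 \<le> i \<Longrightarrow> i + 2 \<le> n \<Longrightarrow> (\<Sum>l\<in>{i<..<n}. A i l * b l) = A i n"
    using last_column_system_solvable[of n A 1] super n by auto
  define A' where "A' i j = (if j = n then A i n - (\<Sum>l=1..<n. A i l * b l) else A i j)" for i j
  have trunc: "(\<Sum>l=1..<n. A i l * b l) = (\<Sum>l\<in>{i<..<n}. A i l * b l)" if "i \<in> {1..n}" for i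
    using that upper by (intro sum.mono_neutral_right) auto
  have upper': "A' i j = 0" if "i \<in> {1..n}" "j \<in> {1..n}" "j \<le> i" for i j
    using that upper trunc by (auto simp: A'_def)
  have super': "A' i (i + 1) \<noteq> 0" if "1 \<le> i" "i + 1 \<le> n" for i
  proof (cases "i + 1 = n")
    case True
    then have "{i<..<n} = {}" by auto
    then show ?thesis using that True super[of i] trunc[of i] by (simp add: A'_def)
  next
    case False
    then show ?thesis using that super by (simp add: A'_def)
  qed
  have last': "A' i n = 0" if "1 \<le> i" "i + 2 \<le> n" for i
    using that b trunc[of i] by (simp add: A'_def)
  have iso1: "isomorphic_alg (evo_alg n A) (evo_alg n A')"
    using n upper by (intro evo_alg_shear) (auto simp: A'_def)
  \<comment> \<open>The factors are determined by \<open>c\<^sub>1 = 1\<close> and the requirement that the rescaled superdiagonal be 1;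
    the value at index 0 is arbitrary.\<close>
  define c where "c = rec_nat 1 (\<lambda>i x. if i = 0 then 1 else x\<^sup>2 * A' i (i + 1))"
  have c_Suc: "c (i + 1) = (c i)\<^sup>2 * A' i (i + 1)" if "i \<ge> 1" for i
    using that by (simp add: c_def)
  have c1: "c 1 = 1" by (simp add: c_def)
  have c_ne: "c i \<noteq> 0" if "1 \<le> i" "i \<le> n" for i
    using that
  proof (induction i rule: dec_induct)
    case base
    show ?case using c1 by simp
  next
    case (step i)
    then show ?case using c_Suc[of i] super'[of i] by simp
  qed
  define B where "B i j = (if i \<in> {1..n} \<and> j \<in> {1..n} then (c i)\<^sup>2 / c j * A' i j else 0)" for i j
  have "rescaled n A' B"
    unfolding rescaled_def using c_ne by (intro exI[of _ c]) (auto simp: B_def)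
  then have "isomorphic_alg (evo_alg n A') (evo_alg n B)" by (rule evo_alg_rescaled)
  moreover have "B i (i + 1) = 1" if "1 \<le> i" "i + 1 \<le> n" for i
    using that c_Suc[of i] c_ne[of "i + 1"] by (simp add: B_def)
  then have "max_nilp_matrix n B"
    unfolding max_nilp_matrix_def using upper' last' by (auto simp: B_def)
  ultimately show ?thesis using iso1 isomorphic_alg_trans by blast
qed

lemma max_index_isomorphic_max_nilp:
  fixes E :: "(complex, 'a::ab_group_add) alg"
  assumes n: "n \<ge> 1" and ev: "evolution_algebra E" and dim: "alg_dim E = n"
    and nil: "nilpotent_alg E" and idx: "nilpotency_index E = 2 ^ (n - 1) + 1"
  shows "\<exists>A. max_nilp_matrix n A \<and> isomorphic_alg E (evo_alg n A)"
proof -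
  obtain B where E: "is_algebra E" and B: "natural_basis E B"
    using ev by (auto simp: evolution_algebra_def)
  obtain A0 where A0: "isomorphic_alg E (evo_alg n A0)"
    using natural_basis_isomorphic_evo_alg[OF E B natural_basis_card[OF E B dim n]] by blast
  have "\<exists>k. k \<ge> 1 \<and> alg_power E k = {0}" using nil by (simp add: nilpotent_alg_def)
  then have zero: "alg_power E (2 ^ (n - 1) + 1) = {0}"
    using LeastI_ex[of "\<lambda>k. k \<ge> 1 \<and> alg_power E k = {0}"] idx
    by (simp add: nilpotency_index_def)
  have "\<not> ((2::nat) ^ (n - 1) \<ge> 1 \<and> alg_power E (2 ^ (n - 1)) = {0})"
    using idx not_less_Least[of "2 ^ (n - 1)" "\<lambda>k. k \<ge> 1 \<and> alg_power E k = {0}"]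
    by (simp add: nilpotency_index_def)
  then have nonzero: "alg_power E (2 ^ (n - 1)) \<noteq> {0}" by simp
  have "alg_power (evo_alg n A0) (2 ^ (n - 1) + 1) = {0}"
    using zero isomorphic_alg_power_zero_iff[OF E is_algebra_evo_alg A0, of "2 ^ (n - 1) + 1"]
    by simp
  then obtain A1 where A1: "isomorphic_alg (evo_alg n A0) (evo_alg n A1)"
      "\<forall>i\<in>{1..n}. \<forall>j\<in>{1..n}. j \<le> i \<longrightarrow> A1 i j = 0"
    using nilpotent_evo_alg_triangular[of "2 ^ (n - 1) + 1" n A0] by auto
  have iso: "isomorphic_alg E (evo_alg n A1)" using A0 A1(1) by (rule isomorphic_alg_trans)
  have "alg_power (evo_alg n A1) (2 ^ (n - 1)) \<noteq> {0}"
    using nonzero isomorphic_alg_power_zero_iff[OF E is_algebra_evo_alg iso, of "2 ^ (n - 1)"]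
    by simp
  then have "A1 i (i + 1) \<noteq> 0" if "1 \<le> i" "i + 1 \<le> n" for i
    using superdiagonal_nonzero[of n A1 i] A1(2) that by blast
  then obtain A2 where "max_nilp_matrix n A2" "isomorphic_alg (evo_alg n A1) (evo_alg n A2)"
    using triangular_isomorphic_max_nilp[OF n, of A1] A1(2) by blast
  then show ?thesis using iso isomorphic_alg_trans by blast
qed

section \<open>Isomorphisms between the displayed algebras\<close>

text \<open>
  Downward induction on \<open>i\<close>. If \<open>x\<close> lies in the span of \<open>e\<^sub>i, \<dots>, e\<^sub>n\<close>, every product \<open>x y\<close> lies
  in the span of the tail starting at \<open>i + 1\<close>, and so does its image. Taking \<open>y\<close> to be the
  preimage of \<open>e\<^sub>k\<close> with \<open>k < i\<close>, that image is the coordinate of \<open>f x\<close> at \<open>k\<close> times the square of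
  \<open>e\<^sub>k\<close>, whose coordinate at \<open>k + 1\<close> is non-zero.
\<close>

lemma alg_iso_preserves_tails:
  assumes f: "alg_iso f (evo_alg n A) (evo_alg n B)"
    and A: "\<And>i j. i \<in> {1..n} \<Longrightarrow> j \<in> {1..n} \<Longrightarrow> j \<le> i \<Longrightarrow> A i j = 0"
    and B: "\<And>i. 1 \<le> i \<Longrightarrow> i + 1 \<le> n \<Longrightarrow> B i (i + 1) \<noteq> 0"
    and i: "i \<le> n + 1" and x: "x \<in> carrier (evo_alg n A)"
    and tail: "\<forall>k<i. x k = 0" and k: "k < i"
  shows "f x k = 0"
  using i x tail k
proof (induction i arbitrary: x k rule: inc_induct)
  case base
  have "x l = 0" for l using base by (cases "l \<in> {1..n}") (auto simp: evo_carrier)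
  then have x: "x = 0" by (intro ext) simp
  have "f x = 0" unfolding x by (rule alg_iso_zero[OF is_algebra_evo_alg f])
  then show ?case by simp
next
  case (step i)
  have f_carr: "f y \<in> carrier (evo_alg n B)" if "y \<in> carrier (evo_alg n A)" for y
    using f that by (auto simp: alg_iso_def bij_betw_def)
  show ?case
  proof (cases "k = 0")
    case True
    then show ?thesis using f_carr[OF step.prems(1)] by (simp add: evo_carrier)
  next
    case False
    then have k: "k \<in> {1..n}" "k + 1 \<le> n" using step by auto
    obtain y where y: "y \<in> carrier (evo_alg n A)" "f y = unit_vec k"
      using f unit_vec_carrier[OF k(1), of B] unfolding alg_iso_def bij_betw_def
      by (metis imageE)
    have "mult (evo_alg n A) x y l = 0" if "l < Suc i" for l
    proof -
      have "x j * y j * A j l = 0" if "j \<in> {1..n}" "l \<in> {1..n}" for j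
        using that A[of j l] step.prems(2) \<open>l < Suc i\<close> by (cases "j < i") auto
      then show ?thesis by (auto simp: evo_mult intro!: sum.neutral)
    qed
    then have "f (mult (evo_alg n A) x y) (k + 1) = 0"
      using step carrier_mult[OF is_algebra_evo_alg step.prems(1) y(1)] by auto
    moreover have "f (mult (evo_alg n A) x y) = mult (evo_alg n B) (f x) (unit_vec k)"
      using f step.prems(1) y by (simp add: alg_iso_def)
    ultimately have "f x k * B k (k + 1) = 0"
      using k mult_unit_vec_right[OF k(1), of B "f x"] by simp
    then show ?thesis using B[of k] k by simp
  qed
qed

lemma triangular_rows_independent:
  fixes B :: "nat \<Rightarrow> nat \<Rightarrow> 'k::field"
  assumes upper: "\<And>i j. i \<in> {1..n} \<Longrightarrow> j \<in> {1..n} \<Longrightarrow> j \<le> i \<Longrightarrow> B i j = 0"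
    and super: "\<And>i. 1 \<le> i \<Longrightarrow> i + 1 \<le> n \<Longrightarrow> B i (i + 1) \<noteq> 0"
    and zero: "\<And>l. l \<in> {1..n} \<Longrightarrow> (\<Sum>m=1..n. u m * B m l) = 0"
    and k: "1 \<le> k" "k + 1 \<le> n"
  shows "u k = 0"
  using k
proof (induction k rule: less_induct)
  case (less k)
  have "u m * B m (k + 1) = (if m = k then u k * B k (k + 1) else 0)" if "m \<in> {1..n}" for m
  proof (cases "m < k")
    case True
    then have "u m = 0" using less.IH[of m] less.prems that by simp
    then show ?thesis using True by simp
  next
    case False
    then show ?thesis using upper[of m "k + 1"] less.prems that by auto
  qed
  then have "(\<Sum>m=1..n. u m * B m (k + 1)) =
      (\<Sum>m=1..n. if m = k then u k * B k (k + 1) else 0)"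
    by (rule sum.cong[OF refl])
  then have "(\<Sum>m=1..n. u m * B m (k + 1)) = u k * B k (k + 1)"
    using less.prems by simp
  then show ?case using zero[of "k + 1"] super[of k] less.prems by simp
qed

text \<open>
  Let \<open>P\<close> be the matrix of the isomorphism. Tails are preserved in both directions, so \<open>P\<close> is upper
  triangular with non-zero diagonal. Orthogonality of the images of \<open>e\<^sub>i\<close> and \<open>e\<^sub>j\<close> and
  independence of the rows of \<open>B\<close> other than the last one give \<open>P\<^sub>i\<^sub>k P\<^sub>j\<^sub>k = 0\<close> for \<open>k < n\<close>. As
  \<open>P\<^sub>k\<^sub>k \<noteq> 0\<close>, each column but the last is zero off the diagonal. Comparing the coordinates of
  the images of squares gives \<open>A\<^sub>i\<^sub>j P\<^sub>j\<^sub>j = P\<^sub>i\<^sub>i\<^sup>2 B\<^sub>i\<^sub>j\<close>, which is a rescaling by the inverses of the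
  diagonal entries.
\<close>

lemma isomorphic_max_nilp_rescaled:
  assumes mA: "max_nilp_matrix n A" and mB: "max_nilp_matrix n B"
    and iso: "isomorphic_alg (evo_alg n A) (evo_alg n B)"
  shows "rescaled n A B"
proof -
  let ?A = "evo_alg n A" and ?B = "evo_alg n B"
  obtain f where f: "alg_iso f ?A ?B" using iso unfolding isomorphic_alg_iff by blast
  define g where "g = inv_into (carrier ?A) f"
  have g: "alg_iso g ?B ?A" unfolding g_def by (rule alg_iso_inv[OF is_algebra_evo_alg f])
  have upA: "A i j = 0" if "i \<in> {1..n}" "j \<in> {1..n}" "j \<le> i" for i j
    using mA that unfolding max_nilp_matrix_def by blast
  have upB: "B i j = 0" if "i \<in> {1..n}" "j \<in> {1..n}" "j \<le> i" for i j
    using mB that unfolding max_nilp_matrix_def by blast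
  have supA: "A i (i + 1) = 1" if "1 \<le> i" "i + 1 \<le> n" for i
    using mA that unfolding max_nilp_matrix_def by blast
  have supB: "B i (i + 1) = 1" if "1 \<le> i" "i + 1 \<le> n" for i
    using mB that unfolding max_nilp_matrix_def by blast
  have lastA: "A i n = 0" if "1 \<le> i" "i + 2 \<le> n" for i
    using mA that unfolding max_nilp_matrix_def by blast
  have lastB: "B i n = 0" if "1 \<le> i" "i + 2 \<le> n" for i
    using mB that unfolding max_nilp_matrix_def by blast
  define P where "P i = f (unit_vec i)" for i
  have P_carr: "P i \<in> carrier ?B" if "i \<in> {1..n}" for i
    using f unit_vec_carrier[OF that, of A] by (auto simp: P_def alg_iso_def bij_betw_def)
  have P_upper: "P i k = 0" if "i \<in> {1..n}" "k < i" for i k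
    unfolding P_def
  proof (rule alg_iso_preserves_tails[OF f upA, of i])
    show "\<forall>k<i. unit_vec i k = (0::complex)" by (simp add: unit_vec_def)
    show "B i (i + 1) \<noteq> 0" if "1 \<le> i" "i + 1 \<le> n" for i using supB[OF that] by simp
  qed (use that in \<open>auto intro: unit_vec_carrier\<close>)
  have P_diag: "P i i \<noteq> 0" if i: "i \<in> {1..n}" for i
  proof
    assume "P i i = 0"
    then have tail: "\<forall>k<i + 1. P i k = 0"
      using P_upper[OF i] by (metis less_add_one less_antisym Suc_eq_plus1)
    have "g (P i) i = 0"
    proof (rule alg_iso_preserves_tails[OF g upB _ _ P_carr[OF i] tail])
      show "A i (i + 1) \<noteq> 0" if "1 \<le> i" "i + 1 \<le> n" for i using supA[OF that] by simp
    qed (use i in auto)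
    moreover have "g (P i) = unit_vec i"
      using f unit_vec_carrier[OF i, of A] unfolding g_def P_def alg_iso_def
      by (meson bij_betw_inv_into_left)
    ultimately show False by (simp add: unit_vec_def)
  qed
  have P_mult: "f (mult ?A (unit_vec i) (unit_vec j)) = mult ?B (P i) (P j)"
    if "i \<in> {1..n}" "j \<in> {1..n}" for i j
    using f that unit_vec_carrier[of _ n A] by (simp add: alg_iso_def P_def)
  have P_orth: "P i k * P j k = 0"
    if ij: "i \<in> {1..n}" "j \<in> {1..n}" "i \<noteq> j" and k: "1 \<le> k" "k + 1 \<le> n" for i j k
  proof (rule triangular_rows_independent[where B = B and n = n])
    show "B i (i + 1) \<noteq> 0" if "1 \<le> i" "i + 1 \<le> n" for i using supB[OF that] by simp
    fix l assume l: "l \<in> {1..n}"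
    have "mult ?A (unit_vec i) (unit_vec j) = 0"
      using mult_unit_vec[of i n j A] ij by simp
    then have "mult ?B (P i) (P j) l = 0"
      using P_mult[OF ij(1,2)] alg_iso_zero[OF is_algebra_evo_alg f] by simp
    then show "(\<Sum>m=1..n. P i m * P j m * B m l) = 0" using l by (simp add: evo_mult)
  qed (use upB k in auto)
  have P_off: "P i k = 0" if "i \<in> {1..n}" "1 \<le> k" "k + 1 \<le> n" "i \<noteq> k" for i k
    using P_orth[of i k k] P_diag[of k] that by simp
  have square: "(\<Sum>j=1..n. A i j * P j l) = (P i i)\<^sup>2 * B i l"
    if i: "i \<in> {1..n}" and l: "l \<in> {1..n}" for i l
  proof -
    have sq: "mult ?A (unit_vec i) (unit_vec i) j = A i j" if "j \<in> {1..n}" for j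
      using mult_unit_vec_right[OF i, of A "unit_vec i"] that by (simp add: unit_vec_def)
    have "f (mult ?A (unit_vec i) (unit_vec i)) l = (\<Sum>j=1..n. A i j * P j l)"
      using alg_iso_evo_expand[OF f carrier_mult[OF is_algebra_evo_alg
          unit_vec_carrier[OF i] unit_vec_carrier[OF i]], of l] sq
      by (simp add: P_def)
    then have "(\<Sum>j=1..n. A i j * P j l) = (\<Sum>k=1..n. P i k * P i k * B k l)"
      using P_mult[OF i i] l by (simp add: evo_mult)
    also have "\<dots> = (\<Sum>k=1..n. if k = i then (P i i)\<^sup>2 * B i l else 0)"
    proof (intro sum.cong refl)
      \<comment> \<open>The entry \<open>P i n\<close> may be non-zero, but it is multiplied by the last row of \<open>B\<close>, which is 0.\<close>
      fix k assume k: "k \<in> {1..n}"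
      show "P i k * P i k * B k l = (if k = i then (P i i)\<^sup>2 * B i l else 0)"
      proof (cases "k = i \<or> k = n")
        case True
        then show ?thesis using upB[of n l] l k by (auto simp: power2_eq_square)
      next
        case False
        then show ?thesis using P_off[of i k] i k by simp
      qed
    qed
    finally show ?thesis using i by simp
  qed
  have scaling: "A i j * P j j = (P i i)\<^sup>2 * B i j"
    if i: "i \<in> {1..n}" and j: "j \<in> {1..n}" for i j
  proof -
    consider "j \<le> i" | "i + 2 \<le> j" "j = n" | "j < n" | "j = n" "j = i + 1"
      using j by fastforce
    then show ?thesis
    proof cases
      case 1
      then show ?thesis using upA upB i j by simp
    next
      case 2
      then show ?thesis using lastA[of i] lastB[of i] i by simp
    next
      case 3
      then have "A i m * P m j = (if m = j then A i j * P j j else 0)" if "m \<in> {1..n}" for m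
        using P_off[of m j] that j by simp
      then have "(\<Sum>m=1..n. A i m * P m j) = (\<Sum>m=1..n. if m = j then A i j * P j j else 0)"
        by (rule sum.cong[OF refl])
      then show ?thesis using square[OF i j] j by simp
    next
      case 4
      then have "A i m * P m j = (if m = j then A i j * P j j else 0)" if "m \<in> {1..n}" for m
        using upA[of i m] i that by auto
      then have "(\<Sum>m=1..n. A i m * P m j) = (\<Sum>m=1..n. if m = j then A i j * P j j else 0)"
        by (rule sum.cong[OF refl])
      then show ?thesis using square[OF i j] j by simp
    qed
  qed
  show ?thesis
    unfolding rescaled_def
  proof (intro exI[of _ "\<lambda>i. 1 / P i i"] conjI ballI)
    fix i j assume ij: "i \<in> {1..n}" "j \<in> {1..n}"
    show "B i j = (1 / P i i)\<^sup>2 / (1 / P j j) * A i j"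
      using scaling[OF ij] P_diag[OF ij(1)] by (simp add: field_simps)
  qed (use P_diag in simp)
qed

section \<open>Choice of normal forms\<close>

lemma rescaled_refl: "rescaled n A A"
  unfolding rescaled_def by (intro exI[of _ "\<lambda>_. 1"]) simp

lemma rescaled_sym:
  assumes "rescaled n A B"
  shows "rescaled n B A"
proof -
  obtain c where c: "\<And>i. i \<in> {1..n} \<Longrightarrow> c i \<noteq> 0"
    and B: "\<And>i j. i \<in> {1..n} \<Longrightarrow> j \<in> {1..n} \<Longrightarrow> B i j = (c i)\<^sup>2 / c j * A i j"
    using assms unfolding rescaled_def by blast
  show ?thesis
    unfolding rescaled_def
    by (intro exI[of _ "\<lambda>i. 1 / c i"]) (use c in \<open>auto simp: B power2_eq_square\<close>)
qed

lemma rescaled_trans: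
  assumes "rescaled n A B" "rescaled n B C"
  shows "rescaled n A C"
proof -
  obtain c where c: "\<And>i. i \<in> {1..n} \<Longrightarrow> c i \<noteq> 0"
    and B: "\<And>i j. i \<in> {1..n} \<Longrightarrow> j \<in> {1..n} \<Longrightarrow> B i j = (c i)\<^sup>2 / c j * A i j"
    using assms(1) unfolding rescaled_def by blast
  obtain d where d: "\<And>i. i \<in> {1..n} \<Longrightarrow> d i \<noteq> 0"
    and C: "\<And>i j. i \<in> {1..n} \<Longrightarrow> j \<in> {1..n} \<Longrightarrow> C i j = (d i)\<^sup>2 / d j * B i j"
    using assms(2) unfolding rescaled_def by blast
  show ?thesis
    unfolding rescaled_def
    by (intro exI[of _ "\<lambda>i. c i * d i"]) (use c d in \<open>auto simp: B C power_mult_distrib mult.commute\<close>)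
qed

definition normalized :: "nat \<Rightarrow> (nat \<Rightarrow> nat \<Rightarrow> complex) \<Rightarrow> bool" where
  "normalized n A \<longleftrightarrow> ((\<exists>(i, j)\<in>free_positions n. A i j \<noteq> 0) \<longrightarrow>
     (\<exists>(i, j)\<in>free_positions n. A i j = 1))"

lemma complex_root_exists:
  fixes a :: complex
  assumes "m > 0"
  shows "\<exists>t. t ^ m = a"
proof (cases "a = 0")
  case True
  then show ?thesis using assms by (intro exI[of _ 0]) simp
next
  case False
  then have "card {t. t ^ m = a} = m" using assms by (rule card_nth_roots)
  then have "{t. t ^ m = a} \<noteq> {}" using assms by force
  then show ?thesis by blast
qed

text \<open>
  The rescalings \<open>c\<^sub>i = t\<^bsup>2^(i-1)\<^esup>\<close> are those that keep the superdiagonal equal to 1. They divide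
  the entry at \<open>(p, q)\<close> by \<open>t\<close> to the power \<open>2\<^sup>q\<^sup>-\<^sup>1 - 2\<^sup>p\<close>, which is positive because
  \<open>q \<ge> p + 2\<close>, so a suitable root \<open>t\<close> turns a chosen non-zero entry into 1.
\<close>

lemma max_nilp_rescaled_normalized:
  assumes A: "max_nilp_matrix n A"
  shows "\<exists>B. max_nilp_matrix n B \<and> normalized n B \<and> rescaled n A B"
proof (cases "\<exists>(i, j)\<in>free_positions n. A i j \<noteq> 0")
  case False
  then have "normalized n A" unfolding normalized_def by blast
  then show ?thesis using A rescaled_refl by blast
next
  case True
  then obtain p q where pq: "(p, q) \<in> free_positions n" "A p q \<noteq> 0" by blast
  then have p: "1 \<le> p" "p + 2 \<le> q" "q + 1 \<le> n" by (auto simp: free_positions_def)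
  then have "(2::nat) ^ p < 2 ^ (q - 1)" by (intro power_strict_increasing) auto
  then obtain t where t: "t ^ (2 ^ (q - 1) - 2 ^ p) = A p q"
    using complex_root_exists[of "2 ^ (q - 1) - 2 ^ p" "A p q"] by auto
  have t0: "t \<noteq> 0"
  proof
    assume "t = 0"
    then show False
      using t pq(2) \<open>(2::nat) ^ p < 2 ^ (q - 1)\<close> by (simp add: zero_power)
  qed
  define c where "c i = t ^ (2 ^ (i - 1))" for i
  have c0: "c i \<noteq> 0" for i using t0 by (simp add: c_def)
  have c2: "(c i)\<^sup>2 = t ^ (2 ^ i)" if "i \<ge> 1" for i
    using that by (cases i) (simp_all add: c_def mult.commute flip: power_mult)
  define B where "B i j = (if i \<in> {1..n} \<and> j \<in> {1..n} then (c i)\<^sup>2 / c j * A i j else 0)" for i j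
  have "rescaled n A B"
    unfolding rescaled_def using c0 by (intro exI[of _ c]) (auto simp: B_def)
  moreover have "max_nilp_matrix n B"
    using A t0 c0 unfolding max_nilp_matrix_def
    by (auto simp: B_def c2) (simp add: c_def)
  moreover have "B p q = 1"
  proof -
    have "t ^ (2 ^ (q - 1)) = t ^ (2 ^ p) * A p q"
      using \<open>(2::nat) ^ p < 2 ^ (q - 1)\<close> by (simp flip: t power_add)
    then show ?thesis using p t0 pq(2) by (simp add: B_def c2) (simp add: c_def)
  qed
  then have "normalized n B" using pq(1) unfolding normalized_def by blast
  ultimately show ?thesis by blast
qed

theorem theorem3p7:
  fixes n :: nat
  assumes "n \<ge> 1"
  shows "\<exists>S. normalized_family n S \<and>
    (\<forall>A\<in>S. \<forall>B\<in>S. A \<noteq> B \<longrightarrow> \<not> isomorphic_alg (evo_alg n A) (evo_alg n B)) \<and>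
    (\<forall>E :: (complex, 'a::ab_group_add) alg.
       evolution_algebra E \<and> alg_dim E = n \<and>
       nilpotent_alg E \<and> nilpotency_index E = 2 ^ (n - 1) + 1 \<longrightarrow>
       (\<exists>A\<in>S. isomorphic_alg E (evo_alg n A)))"
proof -
  define R where "R A B \<longleftrightarrow> max_nilp_matrix n B \<and> normalized n B \<and> rescaled n A B" for A B
  \<comment> \<open>The candidates \<open>R A\<close> depend only on the rescaling class of \<open>A\<close>, hence so does the selected one.\<close>
  define \<phi> where "\<phi> A = (SOME B. R A B)" for A
  define S where "S = \<phi> ` {A. max_nilp_matrix n A}"
  have R: "R A (\<phi> A)" if "max_nilp_matrix n A" for A
  proof -
    have "\<exists>B. R A B" using max_nilp_rescaled_normalized[OF that] unfolding R_def .
    then show ?thesis unfolding \<phi>_def by (rule someI_ex[of "R A"])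
  qed
  have \<phi>_cong: "\<phi> A = \<phi> B" if "rescaled n A B" for A B
  proof -
    have "R A C = R B C" for C
      unfolding R_def using that rescaled_sym rescaled_trans by metis
    then have "R A = R B" by blast
    then show ?thesis by (simp add: \<phi>_def)
  qed
  have family: "normalized_family n S"
    unfolding normalized_family_def
    using R by (auto simp: S_def R_def normalized_def)
  have distinct: "A = B"
    if AB: "A \<in> S" "B \<in> S" and iso: "isomorphic_alg (evo_alg n A) (evo_alg n B)" for A B
  proof -
    obtain A0 B0 where 0: "max_nilp_matrix n A0" "A = \<phi> A0" "max_nilp_matrix n B0" "B = \<phi> B0"
      using AB unfolding S_def by blast
    have "rescaled n A0 A" "rescaled n B0 B" "rescaled n A B"
      using R[OF 0(1)] R[OF 0(3)] 0 iso isomorphic_max_nilp_rescaled unfolding R_def by blast+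
    then have "rescaled n A0 B0" using rescaled_sym rescaled_trans by blast
    then show ?thesis using \<phi>_cong 0 by simp
  qed
  have complete: "\<exists>A\<in>S. isomorphic_alg E (evo_alg n A)"
    if E: "evolution_algebra E" "alg_dim E = n" "nilpotent_alg E"
      "nilpotency_index E = 2 ^ (n - 1) + 1" for E :: "(complex, 'a) alg"
  proof -
    obtain A where A: "max_nilp_matrix n A" "isomorphic_alg E (evo_alg n A)"
      using max_index_isomorphic_max_nilp[OF assms E] by blast
    then have "isomorphic_alg E (evo_alg n (\<phi> A))"
      using R[of A] evo_alg_rescaled isomorphic_alg_trans unfolding R_def by blast
    then show ?thesis using A(1) by (auto simp: S_def)
  qed
  show ?thesis
    by (intro exI[of _ S] conjI) (use family distinct complete in blast)+
qed

end
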